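(* Let $\alpha\in(0,1/2)$ and let $g(x):=\log(1+x)-x$, which satisfies $g\le0$ on $(-1,\infty)$. For any $d$-regular graph $H$ on the vertex set $S=\{1,\dots,k\}$ and any types $a\in[\alpha,1-\alpha]^k$, $$\mathbb P(G[S]=H\mid a)=\bar a^{\,m}(1-\bar a)^{K-m}\exp\Bigl(\sum_{ij\in E(H)}g\bigl(\tfrac{w_{ij}}{\bar a}\bigr)+\sum_{ij\notin E(H)}g\bigl(-\tfrac{w_{ij}}{1-\bar a}\bigr)\Bigr),$$ and every summand in the exponent is nonpositive.
   Context: For types $a=(a_1,\dots,a_k)$ write $\bar a=k^{-1}\sum_i a_i$, $y_i=a_i-\bar a$, $w_{ij}=(y_i+y_j)/2$, $K=\binom k2$, and for a $d$-regular graph $H$ on $S$, $m=kd/2$ (its number of edges). Conditionally on $a$, $G[S]$ is the random graph on $S$ in which each pair $ij$ of distinct vertices is an edge independently with probability $(a_i+a_j)/2$. Sums over $ij\in E(H)$ and $ij\notin E(H)$ are over unordered pairs of distinct vertices of $S$. Logarithms are natural. *)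

theory Defs
  imports "HOL-Probability.Probability" "HOL-Probability.Product_PMF"
begin

text \<open>Simple graphs on a vertex set are represented by their edge sets, an edge being a
  two-element set of vertices; \<open>pairs S\<close> is the edge set of the complete graph on \<open>S\<close>.\<close>

definition pairs :: "'v set \<Rightarrow> 'v set set" where
  "pairs S = {e. e \<subseteq> S \<and> card e = 2}"

definition regular_graph :: "'v set \<Rightarrow> nat \<Rightarrow> 'v set set \<Rightarrow> bool" where
  "regular_graph S d H \<longleftrightarrow> H \<subseteq> pairs S \<and> (\<forall>v\<in>S. card {e \<in> H. v \<in> e} = d)"

text \<open>Only used on two-element sets, see \<open>pair_avg_insert\<close>.\<close>

definition pair_avg :: "('v \<Rightarrow> real) \<Rightarrow> 'v set \<Rightarrow> real" where
  "pair_avg f e = (\<Sum>i\<in>e. f i) / 2"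

lemma pair_avg_insert: "i \<noteq> j \<Longrightarrow> pair_avg f {i, j} = (f i + f j) / 2"
  by (simp add: pair_avg_def)

text \<open>The law of \<open>G[S]\<close> given the types \<open>a\<close>: independent Bernoulli variables indexed by the
  pairs of distinct vertices. \<open>bernoulli_pmf\<close> truncates its parameter to the unit interval,
  which has no effect for types in the unit interval.\<close>

definition random_graph :: "'v set \<Rightarrow> ('v \<Rightarrow> real) \<Rightarrow> 'v set set pmf" where
  "random_graph S a =
     map_pmf (\<lambda>X. {e \<in> pairs S. X e})
       (Pi_pmf (pairs S) False (\<lambda>e. bernoulli_pmf (pair_avg a e)))"

definition type_mean :: "nat \<Rightarrow> (nat \<Rightarrow> real) \<Rightarrow> real" where
  "type_mean k a = (\<Sum>i=1..k. a i) / real k"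

definition w :: "nat \<Rightarrow> (nat \<Rightarrow> real) \<Rightarrow> nat set \<Rightarrow> real" where
  "w k a = pair_avg (\<lambda>i. a i - type_mean k a)"

text \<open>Meaningful on \<open>{-1<..}\<close> only; \<open>ln\<close> is total in HOL.\<close>

definition g :: "real \<Rightarrow> real" where
  "g x = ln (1 + x) - x"

end

theory Submission
  imports Defs
begin

text \<open>Each pair \<open>e\<close> has edge probability \<open>p\<^sub>e = c + w\<^sub>e\<close>, where \<open>c\<close> is the mean type and \<open>w\<^sub>e\<close> is
  the average over \<open>e\<close> of the centred types \<open>a - c\<close>. By independence the probability of \<open>H\<close> is
  the product of \<open>p\<^sub>e\<close> over the edges and of \<open>1 - p\<^sub>e\<close> over the non-edges. Since
  \<open>1 + x = exp (x + g x)\<close> for \<open>x > -1\<close>, these factors are \<open>c * exp (x + g x)\<close> with \<open>x = w\<^sub>e / c\<close>, and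
  \<open>(1 - c) * exp (x + g x)\<close> with \<open>x = - w\<^sub>e / (1 - c)\<close>. It remains to see that the linear terms
  disappear. By double counting, the sum of \<open>w\<^sub>e\<close> over the edges of a \<open>d\<close>-regular graph is
  \<open>d / 2\<close> times the sum of the centred types, which is zero
  (\<open>sum_pair_avg_regular_graph\<close>). This applies to \<open>H\<close> and to the complete graph, hence also
  to the non-edges of \<open>H\<close>. The same double count gives the number of edges.\<close>

lemma finite_pairs: "finite S \<Longrightarrow> finite (pairs S)"
  by (rule finite_subset[of _ "Pow S"]) (auto simp: pairs_def)

lemma card_pairs: "finite S \<Longrightarrow> card (pairs S) = card S choose 2"
  by (simp add: pairs_def n_subsets)

lemma regular_graph_pairs:
  assumes "finite S"
  shows "regular_graph S (card S - 1) (pairs S)"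
  unfolding regular_graph_def
proof (intro conjI ballI subset_refl)
  fix v assume v: "v \<in> S"
  have "{e \<in> pairs S. v \<in> e} = (\<lambda>u. {v, u}) ` (S - {v})"
    using v by (auto simp: pairs_def card_2_iff)
  moreover have "inj_on (\<lambda>u. {v, u}) (S - {v})"
    by (auto simp: inj_on_def doubleton_eq_iff)
  ultimately show "card {e \<in> pairs S. v \<in> e} = card S - 1"
    using v by (simp add: card_image)
qed

text \<open>Double counting of incidences: each vertex contributes \<open>f v / 2\<close> once for each of the
  \<open>d\<close> edges at it.\<close>

lemma sum_pair_avg_regular_graph:
  assumes "finite S" and "regular_graph S d H"
  shows "(\<Sum>e\<in>H. pair_avg f e) = real d / 2 * (\<Sum>v\<in>S. f v)"
proof -
  have H: "H \<subseteq> pairs S" and deg: "\<And>v. v \<in> S \<Longrightarrow> card {e \<in> H. v \<in> e} = d"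
    using assms(2) by (auto simp: regular_graph_def)
  have fin: "finite H"
    using H finite_pairs[OF assms(1)] finite_subset by blast
  have "(\<Sum>e\<in>H. \<Sum>v\<in>e. f v) = (\<Sum>e\<in>H. \<Sum>v\<in>{v \<in> S. v \<in> e}. f v)"
    using H by (intro sum.cong) (auto simp: pairs_def)
  also have "\<dots> = (\<Sum>v\<in>S. \<Sum>e\<in>{e \<in> H. v \<in> e}. f v)"
    by (rule sum.swap_restrict[OF fin assms(1)])
  also have "\<dots> = real d * (\<Sum>v\<in>S. f v)"
    by (simp add: deg sum_distrib_left)
  finally show ?thesis
    by (simp add: pair_avg_def flip: sum_divide_distrib)
qed

lemma card_regular_graph:
  assumes "finite S" and "regular_graph S d H"
  shows "card H = card S * d div 2"
proof -
  have "pair_avg (\<lambda>_. 1) e = 1" if "e \<in> H" for e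
    using that assms(2) by (auto simp: regular_graph_def pairs_def pair_avg_def)
  then have "real (card H) = real d / 2 * real (card S)"
    using sum_pair_avg_regular_graph[OF assms, of "\<lambda>_. 1"] by simp
  then have "real (2 * card H) = real (card S * d)"
    by (simp add: mult.commute)
  then show ?thesis
    by linarith
qed

lemma pmf_random_graph:
  assumes "finite S" and "H \<subseteq> pairs S"
    and p01: "\<And>e. e \<in> pairs S \<Longrightarrow> pair_avg a e \<in> {0..1}"
  shows "pmf (random_graph S a) H =
    (\<Prod>e\<in>H. pair_avg a e) * (\<Prod>e\<in>pairs S - H. 1 - pair_avg a e)"
proof -
  have fin: "finite (pairs S)"
    by (rule finite_pairs[OF assms(1)])
  \<comment> \<open>Drawing \<open>H\<close> is a product event, so independence turns its probability into a product.\<close>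
  have "(\<lambda>X. {e \<in> pairs S. X e}) -` {H} = Pi (pairs S) (\<lambda>e. {e \<in> H})"
    using assms(2) by (auto simp: Pi_def)
  then have "pmf (random_graph S a) H =
      (\<Prod>e\<in>pairs S. pmf (bernoulli_pmf (pair_avg a e)) (e \<in> H))"
    by (simp add: random_graph_def pmf_map measure_Pi_pmf_Pi[OF fin] measure_pmf_single)
  also have "\<dots> = (\<Prod>e\<in>pairs S - H. pmf (bernoulli_pmf (pair_avg a e)) (e \<in> H)) *
      (\<Prod>e\<in>H. pmf (bernoulli_pmf (pair_avg a e)) (e \<in> H))"
    by (rule prod.subset_diff[OF assms(2) fin])
  also have "(\<Prod>e\<in>pairs S - H. pmf (bernoulli_pmf (pair_avg a e)) (e \<in> H)) =
      (\<Prod>e\<in>pairs S - H. 1 - pair_avg a e)"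
    using p01 by (intro prod.cong) auto
  also have "(\<Prod>e\<in>H. pmf (bernoulli_pmf (pair_avg a e)) (e \<in> H)) = (\<Prod>e\<in>H. pair_avg a e)"
    using p01 assms(2) by (intro prod.cong) auto
  finally show ?thesis
    by (simp add: mult.commute)
qed

lemma g_nonpos: "x > -1 \<Longrightarrow> g x \<le> 0"
  using ln_le_minus_one[of "1 + x"] by (simp add: g_def)

text \<open>When the deviations \<open>f\<close> from a common factor \<open>c\<close> sum to zero, the linear parts of the
  logarithms cancel and only the corrections \<open>g\<close> survive.\<close>

lemma prod_add_eq_power_mult_exp_sum_g:
  fixes c :: real
  assumes "c > 0" and "\<And>e. e \<in> A \<Longrightarrow> c + f e > 0" and "(\<Sum>e\<in>A. f e) = 0"
  shows "(\<Prod>e\<in>A. c + f e) = c ^ card A * exp (\<Sum>e\<in>A. g (f e / c))"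
proof (cases "finite A")
  case True
  have "c + f e = c * exp (f e / c + g (f e / c))" if "e \<in> A" for e
  proof -
    have "1 + f e / c = (c + f e) / c"
      using assms(1) by (simp add: field_simps)
    then have "1 + f e / c > 0"
      using assms(1) assms(2)[OF that] by simp
    then show ?thesis
      using assms(1) by (simp add: g_def field_simps)
  qed
  then have "(\<Prod>e\<in>A. c + f e) = (\<Prod>e\<in>A. c * exp (f e / c + g (f e / c)))"
    by (rule prod.cong[OF refl])
  also have "\<dots> = c ^ card A * exp ((\<Sum>e\<in>A. f e) / c + (\<Sum>e\<in>A. g (f e / c)))"
    using True by (simp add: prod.distrib sum.distrib sum_divide_distrib flip: exp_sum)
  finally show ?thesis
    using assms(3) by simp
qed simp

lemma sum_diff_type_mean: "(\<Sum>i=1..k. a i - type_mean k a) = 0"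
  by (cases "k = 0") (simp_all add: type_mean_def sum_subtractf)

lemma pair_avg_eq_type_mean_add_w:
  assumes "card e = 2"
  shows "pair_avg a e = type_mean k a + w k a e"
  using assms by (simp add: w_def pair_avg_def sum_subtractf diff_divide_distrib)

lemma type_mean_bounds:
  assumes "k \<ge> 1" and "\<forall>i\<in>{1..k}. a i \<in> {l..u}"
  shows "type_mean k a \<in> {l..u}"
proof -
  have "real k * l \<le> (\<Sum>i=1..k. a i)" "(\<Sum>i=1..k. a i) \<le> real k * u"
    using sum_bounded_below[of "{1..k}" l a] sum_bounded_above[of "{1..k}" a u] assms(2)
    by auto
  then show ?thesis
    using assms(1) by (simp add: type_mean_def field_simps)
qed

lemma pair_avg_bounds:
  assumes "e \<in> pairs S" and "\<forall>i\<in>S. a i \<in> {l..u}"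
  shows "pair_avg a e \<in> {l..u}"
proof -
  obtain i j where "e = {i, j}" "i \<noteq> j" "i \<in> S" "j \<in> S"
    using assms(1) by (auto simp: pairs_def card_2_iff)
  moreover from this have "l \<le> a i" "a i \<le> u" "l \<le> a j" "a j \<le> u"
    using assms(2) by auto
  ultimately show ?thesis
    by (simp add: pair_avg_insert)
qed

theorem lemma2p1:
  fixes \<alpha> :: real and k d :: nat and H :: "nat set set" and a :: "nat \<Rightarrow> real"
  defines "S \<equiv> {1..k}"
    and "abar \<equiv> type_mean k a"
    and "m \<equiv> k * d div 2"
    and "K \<equiv> k choose 2"
  assumes "0 < \<alpha>" and "\<alpha> < 1 / 2"
    and "k \<ge> 1"
    and "regular_graph S d H"
    and "\<forall>i\<in>S. a i \<in> {\<alpha>..1 - \<alpha>}"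
  shows "(\<forall>x>-1. g x \<le> 0) \<and>
         pmf (random_graph S a) H =
           abar ^ m * (1 - abar) ^ (K - m) *
           exp ((\<Sum>e\<in>H. g (w k a e / abar)) +
                (\<Sum>e\<in>pairs S - H. g (- w k a e / (1 - abar)))) \<and>
         (\<forall>e\<in>H. w k a e / abar > -1 \<and> g (w k a e / abar) \<le> 0) \<and>
         (\<forall>e\<in>pairs S - H. - w k a e / (1 - abar) > -1 \<and> g (- w k a e / (1 - abar)) \<le> 0)"
proof -
  have S: "finite S" "card S = k"
    by (simp_all add: S_def)
  have HS: "H \<subseteq> pairs S"
    using assms(8) by (simp add: regular_graph_def)
  have fin: "finite (pairs S)" "finite H"
    using finite_pairs[OF S(1)] HS finite_subset by blast+
  have abar: "0 < abar" "abar < 1"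
    using type_mean_bounds[of k a \<alpha> "1 - \<alpha>"] assms by auto
  have p: "pair_avg a e = abar + w k a e" "0 < abar + w k a e" "abar + w k a e < 1"
    if "e \<in> pairs S" for e
  proof -
    show "pair_avg a e = abar + w k a e"
      unfolding abar_def using that by (intro pair_avg_eq_type_mean_add_w) (simp add: pairs_def)
    then show "0 < abar + w k a e" "abar + w k a e < 1"
      using pair_avg_bounds[OF that assms(9)] \<open>0 < \<alpha>\<close> by auto
  qed
  have w_sum: "(\<Sum>e\<in>F. w k a e) = 0" if "regular_graph S r F" for F r
    unfolding w_def sum_pair_avg_regular_graph[OF S(1) that]
    by (simp only: S_def sum_diff_type_mean mult_zero_right)
  have w_sum_H: "(\<Sum>e\<in>H. w k a e) = 0"
    by (rule w_sum[OF assms(8)])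
  have w_sum_nonedges: "(\<Sum>e\<in>pairs S - H. - w k a e) = 0"
    using w_sum[OF regular_graph_pairs[OF S(1)]] w_sum_H HS fin
    by (simp add: sum_negf sum_diff)
  have card_H: "card H = m"
    using card_regular_graph[OF S(1) assms(8)] by (simp add: S m_def)
  have card_nonedges: "card (pairs S - H) = K - m"
    using HS fin card_H by (simp add: card_Diff_subset card_pairs S K_def)
  have "pmf (random_graph S a) H =
      (\<Prod>e\<in>H. pair_avg a e) * (\<Prod>e\<in>pairs S - H. 1 - pair_avg a e)"
    using p by (intro pmf_random_graph[OF S(1) HS]) (simp add: less_imp_le)
  also have "(\<Prod>e\<in>H. pair_avg a e) = (\<Prod>e\<in>H. abar + w k a e)"
    using p HS by (intro prod.cong) auto
  also have "\<dots> = abar ^ card H * exp (\<Sum>e\<in>H. g (w k a e / abar))"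
    using p HS by (intro prod_add_eq_power_mult_exp_sum_g abar w_sum_H) auto
  also have "(\<Prod>e\<in>pairs S - H. 1 - pair_avg a e) = (\<Prod>e\<in>pairs S - H. (1 - abar) + - w k a e)"
    using p by (intro prod.cong) auto
  also have "\<dots> = (1 - abar) ^ card (pairs S - H) *
      exp (\<Sum>e\<in>pairs S - H. g (- w k a e / (1 - abar)))"
    using p abar by (intro prod_add_eq_power_mult_exp_sum_g w_sum_nonedges) force+
  finally have pmf: "pmf (random_graph S a) H =
      abar ^ m * (1 - abar) ^ (K - m) *
      exp ((\<Sum>e\<in>H. g (w k a e / abar)) + (\<Sum>e\<in>pairs S - H. g (- w k a e / (1 - abar))))"
    by (simp add: exp_add card_H card_nonedges)
  have edge: "w k a e / abar > -1" if "e \<in> H" for e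
    using p(2)[of e] that HS abar by (auto simp: field_simps)
  have nonedge: "- w k a e / (1 - abar) > -1" if "e \<in> pairs S - H" for e
    using p(3)[of e] that abar by (auto simp: field_simps)
  show ?thesis
    using pmf edge nonedge g_nonpos by blast
qed

end
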